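(* Let $N,K,k$ be positive integers with $K\ge 2$ and $k<N$. Model composition chains as pointer chasing: keyframe $i\in[N]$ carries a pointer $p_i\sim\mathrm{Unif}[N]$ and an attribute $a_i\sim\mathrm{Unif}[K]$, all independent, and the depth-$2$ query $q$ is "report $a_{p_J}$" for a queried index $J\sim\mathrm{Unif}[N]$ independent of everything else. Let an agent's retrieval be confined to a single non-adaptive round returning a set $W$ of keyframes, $|W|\le k$, chosen from $(q,s_N)$ before any retrieved content is read, where $s_N$ is the agent's cross-frame state. Let $\hat y$ be the agent's answer and $y^\star=a_{p_J}$. Then: (i) (no cross-frame state) If the agent has no cross-frame state, then $\Pr[\hat y=y^\star]\le \frac kN+\bigl(1-\frac kN\bigr)\frac1K$. (ii) (localisation, $m$-bit state) If $s_N$ is an $m$-bit state, then the round reaches the keyframe that carries the answer with probability $$\Pr[p_J\in W]\;\le\;\frac{m/N+1}{\log_2(N/k)},$$ which for $m=o(N\log_2N)$ (and $k$ fixed, $N\to\infty$) tends to $0$ however the state is computed. (iii) (capability, $m$-bit state) If in addition to having an $m$-bit state the agent is read-grounded, then $$\Pr[\hat y=y^\star]\;\le\;\frac{m/N+1}{\log_2(N/k)}+\frac1K .$$ Moreover, for chains of depth $d_q$, an agent with $R\ge d_q$ adaptive rounds resolves one hop per round with $O(1)$ retrievals each and answers correctly with probability at least $1-d_q\epsilon_1$ under the representational sufficiency assumption with per-round composition error $\epsilon_1$.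
   Context: The state $s_N=\sigma(\text{stream})$ is an arbitrary (possibly randomized, computationally unbounded) function of the stream, computed before the query is known; an $m$-bit state takes values in $\{0,1\}^m$. After choosing $W$, the agent reads the contents $(p_i,a_i)$, $i\in W$, and answers; compute is unbounded. Read-only retrieval convention: an access to the verbatim store reveals the contents of the returned items and nothing about the items not returned. Read-grounded: the agent's answer is a function of the contents it has actually read, $\{(p_i,a_i)\}_{i\in W}$, together with $(q,W)$, and not of $s_N$ except through the choice of $W$. Representational sufficiency assumption: the frozen backbone answers single-keyframe attribute queries with accuracy at least $1-\epsilon_0$ when the relevant keyframe is in context, and executes one composition step with accuracy at least $1-\epsilon_1$ per round. Adaptive rounds: the keyframes requested in a round may depend on contents read in earlier rounds. A depth-$d_q$ chain requires $d_q$ dependent lookups, each hop's target being determined by the content read at the previous hop.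
   Formalization: In (iii) the read-only convention is made an explicit hypothesis: given the pointers, J, W and the contents read, each attribute not returned is still uniform; otherwise the choice of W could encode the answer and the bound in (iii) would fail. *)

theory Defs
  imports "HOL-Probability.Probability" "HOL-Library.Landau_Symbols"
begin

text \<open>
  Keyframes are numbered \<open>0, \<dots>, N - 1\<close> and attribute values \<open>0, \<dots>, K - 1\<close>. A stream maps a keyframe
  to its contents (pointer, attribute).
\<close>

type_synonym stream = "nat \<Rightarrow> nat \<times> nat"
type_synonym contents = "nat \<rightharpoonup> nat \<times> nat"

definition ptr :: "stream \<Rightarrow> nat \<Rightarrow> nat" where
  "ptr x i = fst (x i)"

definition attr :: "stream \<Rightarrow> nat \<Rightarrow> nat" where
  "attr x i = snd (x i)"

text \<open>\<open>Pi_pmf\<close> makes the entries independent; outside \<open>{..<N}\<close> a stream has the dummy value \<open>(0, 0)\<close>.\<close>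

definition stream_pmf :: "nat \<Rightarrow> nat \<Rightarrow> stream pmf" where
  "stream_pmf N K =
     Pi_pmf {..<N} (0, 0) (\<lambda>_. pair_pmf (pmf_of_set {..<N}) (pmf_of_set {..<K}))"

definition read :: "stream \<Rightarrow> nat set \<Rightarrow> contents" where
  "read x W = (\<lambda>i. Some (x i)) |` W"

text \<open>The answer to the depth-\<open>d\<close> query at \<open>j\<close>, for \<open>d \<ge> 1\<close>: \<open>d - 1\<close> pointer lookups and one attribute lookup.\<close>

definition chain_answer :: "stream \<Rightarrow> nat \<Rightarrow> nat \<Rightarrow> nat" where
  "chain_answer x d j = attr x ((ptr x ^^ (d - 1)) j)"

lemma chain_answer_2: "chain_answer x 2 j = attr x (ptr x j)"
  by (simp add: chain_answer_def)


subsection \<open>Agents with a single non-adaptive retrieval round\<close>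

text \<open>
  All three components are Markov kernels, so each may be randomized. The state depends on the stream
  only, the retrieved set on the query and the state only. The answer may in general also use the
  state; \<open>read_grounded\<close> below excludes this.
\<close>

record 's agent =
  state :: "stream \<Rightarrow> 's pmf"
  select :: "nat \<Rightarrow> 's \<Rightarrow> nat set pmf"
  answer :: "nat \<Rightarrow> 's \<Rightarrow> nat set \<Rightarrow> contents \<Rightarrow> nat pmf"

text \<open>Joint law of the stream, the queried index \<open>J\<close>, the retrieved set \<open>W\<close> and the answer.\<close>

definition run :: "nat \<Rightarrow> nat \<Rightarrow> 's agent \<Rightarrow> (stream \<times> nat \<times> nat set \<times> nat) pmf" where
  "run N K ag = do {
     x \<leftarrow> stream_pmf N K;
     s \<leftarrow> state ag x;
     j \<leftarrow> pmf_of_set {..<N};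
     W \<leftarrow> select ag j s;
     y \<leftarrow> answer ag j s W (read x W);
     return_pmf (x, j, W, y)
   }"

definition retrieves_at_most :: "nat \<Rightarrow> nat \<Rightarrow> nat \<Rightarrow> 's agent \<Rightarrow> bool" where
  "retrieves_at_most N K k ag \<longleftrightarrow>
     (\<forall>x\<in>set_pmf (stream_pmf N K). \<forall>s\<in>set_pmf (state ag x). \<forall>j<N. \<forall>W\<in>set_pmf (select ag j s).
        W \<subseteq> {..<N} \<and> card W \<le> k)"

definition bit_state :: "nat \<Rightarrow> nat \<Rightarrow> nat \<Rightarrow> bool list agent \<Rightarrow> bool" where
  "bit_state N K m ag \<longleftrightarrow>
     (\<forall>x\<in>set_pmf (stream_pmf N K). \<forall>s\<in>set_pmf (state ag x). length s = m)"

definition read_grounded :: "'s agent \<Rightarrow> bool" where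
  "read_grounded ag \<longleftrightarrow> (\<forall>j s s' W c. answer ag j s W c = answer ag j s' W c)"

text \<open>
  The read-only retrieval convention: an access reveals nothing about the items not returned. It is
  stated for attributes: conditionally on the query, the retrieved set, the contents read and the
  pointers, the attribute of an item that was not returned is still uniform. This does not follow
  from \<open>read_grounded\<close>, since \<open>W\<close> is computed from a state that may depend on attributes, and the mere
  choice of \<open>W\<close> could therefore encode an attribute that was never read. Pointers are left
  unconstrained: \<open>W\<close> may depend on them in any way. The equation is the conditional-probability
  statement multiplied out.
\<close>

definition transcript :: "stream \<Rightarrow> nat \<Rightarrow> nat set \<Rightarrow> (nat \<Rightarrow> nat) \<times> nat \<times> nat set \<times> contents" where
  "transcript x j W = (ptr x, j, W, read x W)"

definition read_only_retrieval :: "nat \<Rightarrow> nat \<Rightarrow> 's agent \<Rightarrow> bool" where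
  "read_only_retrieval N K ag \<longleftrightarrow>
     (\<forall>\<pi> j W c. \<forall>i\<in>{..<N} - W. \<forall>v<K.
        measure_pmf.prob (run N K ag)
          {(x, j', W', y). transcript x j' W' = (\<pi>, j, W, c) \<and> attr x i = v} =
        measure_pmf.prob (run N K ag)
          {(x, j', W', y). transcript x j' W' = (\<pi>, j, W, c)} / real K)"


subsection \<open>Agents with adaptive rounds\<close>

text \<open>
  In each round the request is computed from the working memory, which may depend on everything
  read in earlier rounds.
\<close>

record 'c adaptive_agent =
  init :: "nat \<Rightarrow> 'c"
  request :: "'c \<Rightarrow> nat set"
  advance :: "'c \<Rightarrow> contents \<Rightarrow> 'c pmf"
  final_answer :: "'c \<Rightarrow> nat"

primrec rounds :: "'c adaptive_agent \<Rightarrow> stream \<Rightarrow> nat \<Rightarrow> 'c \<Rightarrow> 'c pmf" where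
  "rounds ag x 0 c = return_pmf c"
| "rounds ag x (Suc r) c = bind_pmf (advance ag c (read x (request ag c))) (rounds ag x r)"

text \<open>Joint law of the stream, the queried index and the working memory after \<open>R\<close> rounds.\<close>

definition adaptive_run :: "nat \<Rightarrow> nat \<Rightarrow> 'c adaptive_agent \<Rightarrow> nat \<Rightarrow> (stream \<times> nat \<times> 'c) pmf" where
  "adaptive_run N K ag R = do {
     x \<leftarrow> stream_pmf N K;
     j \<leftarrow> pmf_of_set {..<N};
     c \<leftarrow> rounds ag x R (init ag j);
     return_pmf (x, j, c)
   }"

text \<open>
  \<open>attr_query B i ctx\<close> answers the attribute query for keyframe \<open>i\<close> given the context \<open>ctx\<close>.
  \<open>compose B final i ctx\<close> executes one composition step, that is one of the \<open>d\<close> dependent lookups of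
  a depth-\<open>d\<close> chain: at keyframe \<open>i\<close> it should output the pointer, or the attribute if the lookup is
  the last one of the chain (\<open>final\<close>).
\<close>

record backbone =
  attr_query :: "nat \<Rightarrow> contents \<Rightarrow> nat pmf"
  compose :: "bool \<Rightarrow> nat \<Rightarrow> contents \<Rightarrow> nat pmf"

definition representationally_sufficient ::
    "nat \<Rightarrow> nat \<Rightarrow> backbone \<Rightarrow> real \<Rightarrow> real \<Rightarrow> bool" where
  "representationally_sufficient N K B \<epsilon>\<^sub>0 \<epsilon>\<^sub>1 \<longleftrightarrow>
     (\<forall>x\<in>set_pmf (stream_pmf N K). \<forall>W\<subseteq>{..<N}. \<forall>i\<in>W.
        pmf (attr_query B i (read x W)) (attr x i) \<ge> 1 - \<epsilon>\<^sub>0 \<and>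
        pmf (compose B False i (read x W)) (ptr x i) \<ge> 1 - \<epsilon>\<^sub>1 \<and>
        pmf (compose B True i (read x W)) (attr x i) \<ge> 1 - \<epsilon>\<^sub>1)"

text \<open>
  The agent that executes one hop of a depth-\<open>d\<close> chain per round. Its memory is the number of
  lookups still to be made and the result of the last lookup; it idles once the chain is finished.
  The intersection with \<open>{..<N}\<close> matters only after an erroneous step.
\<close>

definition hop_agent :: "nat \<Rightarrow> nat \<Rightarrow> backbone \<Rightarrow> (nat \<times> nat) adaptive_agent" where
  "hop_agent N d B = \<lparr>
     init = (\<lambda>j. (d, j)),
     request = (\<lambda>(h, v). if h = 0 then {} else {v} \<inter> {..<N}),
     advance = (\<lambda>(h, v) ctx. if h = 0 then return_pmf (h, v)
                              else map_pmf (Pair (h - 1)) (compose B (h = 1) v ctx)),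
     final_answer = snd \<rparr>"

text \<open>The correct memory of that agent after \<open>r \<le> d\<close> rounds.\<close>

definition resolved :: "stream \<Rightarrow> nat \<Rightarrow> nat \<Rightarrow> nat \<Rightarrow> nat \<times> nat" where
  "resolved x d j r = (d - r, if r < d then (ptr x ^^ r) j else chain_answer x d j)"

end

theory Submission
  imports Defs "HOL-Real_Asymp.Real_Asymp"
begin

text \<open>
  The localisation bound is an exponential-moment argument in place of Fano's inequality. Fix a state
  \<open>s\<close>, let \<open>Z x s\<close> be the expected number of queries \<open>j\<close> whose retrieved set contains the pointer
  of \<open>j\<close>, and put \<open>l = ln (N / k)\<close>. The pointers are independent and each retrieved set has at most
  \<open>k\<close> elements, so \<open>exp (l * Z x s)\<close> has expectation at most
  \<open>(1 + (k / N) * (exp l - 1)) ^ N \<le> 2 ^ N\<close>. Summing over the at most \<open>2 ^ m\<close> states removes the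
  dependence of the state on the stream, and \<open>1 + t \<le> exp t\<close> turns this into
  \<open>l * E[Z] \<le> (m + N) * ln 2\<close>.

  If the pointer is not in the retrieved set, then given the transcript the answer of a read-grounded
  agent is independent of the target attribute, which is uniform, so it is correct with probability
  at most \<open>1 / K\<close>. An agent without state satisfies the read-only retrieval condition automatically,
  since resampling the attribute of an item that was not returned preserves the law of the stream,
  and it reaches the target with probability at most \<open>k / N\<close>.

  For the adaptive agent the errors of the successive rounds add up.
\<close>

section \<open>Expectations and probabilities under \<open>bind_pmf\<close>\<close>

lemma prob_bind_pmf:
  "measure_pmf.prob (bind_pmf p f) A = measure_pmf.expectation p (\<lambda>x. measure_pmf.prob (f x) A)"
proof -
  have int: "integrable (measure_pmf p) (\<lambda>x. measure_pmf.prob (f x) A)"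
    by (rule measure_pmf.integrable_const_bound[where B=1]) auto
  have "ennreal (measure_pmf.prob (bind_pmf p f) A) = (\<integral>\<^sup>+x. ennreal (measure_pmf.prob (f x) A) \<partial>measure_pmf p)"
    by (simp flip: measure_pmf.emeasure_eq_measure)
  also have "\<dots> = ennreal (measure_pmf.expectation p (\<lambda>x. measure_pmf.prob (f x) A))"
    by (rule nn_integral_eq_integral[OF int]) auto
  finally show ?thesis
    by (simp add: integral_nonneg_AE)
qed

lemma prob_return_pmf: "measure_pmf.prob (return_pmf x) A = of_bool (x \<in> A)"
  by (simp add: measure_return indicator_def)

text \<open>A non-integrable function has Bochner integral 0, so pointwise comparison alone is not
  enough; boundedness on the support supplies integrability.\<close>

lemma expectation_bounded_mono:
  fixes f g :: "'a \<Rightarrow> real"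
  assumes "\<And>x. x \<in> set_pmf p \<Longrightarrow> f x \<le> g x"
    and "\<And>x. x \<in> set_pmf p \<Longrightarrow> \<bar>f x\<bar> \<le> B" and "\<And>x. x \<in> set_pmf p \<Longrightarrow> \<bar>g x\<bar> \<le> C"
  shows "measure_pmf.expectation p f \<le> measure_pmf.expectation p g"
proof (rule integral_mono_AE)
  show "integrable (measure_pmf p) f"
    by (rule measure_pmf.integrable_const_bound[where B=B])
       (use assms in \<open>auto simp: AE_measure_pmf_iff\<close>)
  show "integrable (measure_pmf p) g"
    by (rule measure_pmf.integrable_const_bound[where B=C])
       (use assms in \<open>auto simp: AE_measure_pmf_iff\<close>)
qed (use assms in \<open>auto simp: AE_measure_pmf_iff\<close>)

lemma expectation_le_const:
  fixes f :: "'a \<Rightarrow> real"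
  assumes "\<And>x. x \<in> set_pmf p \<Longrightarrow> f x \<le> c" and "\<And>x. x \<in> set_pmf p \<Longrightarrow> 0 \<le> f x"
  shows "measure_pmf.expectation p f \<le> c"
  using expectation_bounded_mono[of p f "\<lambda>_. c" c "\<bar>c\<bar>"] assms by force

lemma prob_bind_pmf_ge:
  assumes "\<And>x. x \<in> set_pmf p \<Longrightarrow> c \<le> measure_pmf.prob (f x) A"
  shows "c \<le> measure_pmf.prob (bind_pmf p f) A"
proof -
  have "measure_pmf.expectation p (\<lambda>_. c) \<le> measure_pmf.expectation p (\<lambda>x. measure_pmf.prob (f x) A)"
    by (rule expectation_bounded_mono[where B="\<bar>c\<bar>" and C=1]) (use assms in auto)
  then show ?thesis
    by (simp add: prob_bind_pmf)
qed

text \<open>The path through the single intermediate value \<open>y\<close> already contributes the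
  product. This chains the success probabilities of successive rounds.\<close>

lemma pmf_bind_ge_mult: "pmf (bind_pmf p f) z \<ge> pmf p y * pmf (f y) z"
proof -
  have "pmf p y * pmf (f y) z = measure_pmf.expectation p (\<lambda>x. indicator {y} x * pmf (f y) z)"
    by (simp add: measure_pmf_single)
  also have "\<dots> \<le> measure_pmf.expectation p (\<lambda>x. pmf (f x) z)"
    by (rule expectation_bounded_mono[where B=1 and C=1])
       (auto simp: indicator_def pmf_le_1)
  also have "\<dots> = pmf (bind_pmf p f) z"
    by (simp add: pmf_bind)
  finally show ?thesis .
qed

text \<open>By convexity the graph over [0, 1] lies below the chord through its end points. The
  bound is linear in \<open>t\<close>, so sums of exponentials reduce to sums of reach
  probabilities.\<close>

lemma exp_mult_le_chord:
  fixes l t :: real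
  assumes "0 \<le> l" "0 \<le> t" "t \<le> 1"
  shows "exp (l * t) \<le> 1 + t * (exp l - 1)"
  using convex_onD[OF convex_on_exp[OF assms(1)], of t 0 1] assms by (simp add: algebra_simps)


subsection \<open>Streams\<close>

lemma set_pmf_stream:
  assumes "N \<ge> 1" "K \<ge> 1" "x \<in> set_pmf (stream_pmf N K)" "i < N"
  shows "ptr x i < N" and "attr x i < K"
proof -
  have "x i \<in> set_pmf (pair_pmf (pmf_of_set {..<N}) (pmf_of_set {..<K}))"
    using assms(3,4) unfolding stream_pmf_def by (auto simp: set_Pi_pmf PiE_dflt_def)
  moreover have "{..<N} \<noteq> {}" "{..<K} \<noteq> {}"
    using assms(1,2) by (auto simp: lessThan_empty_iff)
  ultimately show "ptr x i < N" and "attr x i < K"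
    by (auto simp: ptr_def attr_def)
qed

lemma finite_set_pmf_stream:
  assumes "N \<ge> 1" "K \<ge> 1"
  shows "finite (set_pmf (stream_pmf N K))"
proof -
  have "{..<N} \<noteq> {}" "{..<K} \<noteq> {}"
    using assms by (auto simp: lessThan_empty_iff)
  then show ?thesis
    unfolding stream_pmf_def by (auto simp: set_Pi_pmf)
qed

lemma map_ptr_stream:
  assumes "N \<ge> 1" "j < N"
  shows "map_pmf (\<lambda>x. ptr x j) (stream_pmf N K) = pmf_of_set {..<N}"
proof -
  have "map_pmf (\<lambda>x. ptr x j) (stream_pmf N K) = map_pmf fst (map_pmf (\<lambda>x. x j) (stream_pmf N K))"
    by (simp add: pmf.map_comp o_def ptr_def)
  also have "map_pmf (\<lambda>x. x j) (stream_pmf N K) = pair_pmf (pmf_of_set {..<N}) (pmf_of_set {..<K})"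
    using assms by (simp add: stream_pmf_def Pi_pmf_component)
  finally show ?thesis
    by (simp add: map_fst_pair_pmf)
qed

lemma expectation_ptr_stream:
  fixes g :: "nat \<Rightarrow> real"
  assumes "N \<ge> 1" "j < N"
  shows "measure_pmf.expectation (stream_pmf N K) (\<lambda>x. g (ptr x j)) = (\<Sum>p<N. g p) / real N"
proof -
  have ne: "{..<N} \<noteq> {}"
    using assms(2) by auto
  have "measure_pmf.expectation (stream_pmf N K) (\<lambda>x. g (ptr x j))
      = measure_pmf.expectation (map_pmf (\<lambda>x. ptr x j) (stream_pmf N K)) g"
    by simp
  also have "\<dots> = (\<Sum>p<N. g p) / real N"
    unfolding map_ptr_stream[OF assms] by (simp add: integral_pmf_of_set ne)
  finally show ?thesis .
qed

text \<open>The factor of \<open>j\<close> depends on the contents of keyframe \<open>j\<close>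
  alone, so independence of the keyframes factors the expectation.\<close>

lemma expectation_prod_stream:
  fixes g :: "nat \<Rightarrow> nat \<Rightarrow> real"
  assumes "N \<ge> 1" "K \<ge> 1" and nonneg: "\<And>j p. 0 \<le> g j p"
  shows "measure_pmf.expectation (stream_pmf N K) (\<lambda>x. \<Prod>j<N. g j (ptr x j))
    = (\<Prod>j<N. (\<Sum>p<N. g j p) / real N)"
proof -
  have ne: "{..<N} \<noteq> {}" "{..<K} \<noteq> {}"
    using assms by (auto simp: lessThan_empty_iff)
  let ?p = "pair_pmf (pmf_of_set {..<N}) (pmf_of_set {..<K})"
  have marginal: "measure_pmf.expectation ?p (\<lambda>z. g j (fst z)) = (\<Sum>p<N. g j p) / real N" for j
  proof -
    have "measure_pmf.expectation ?p (\<lambda>z. g j (fst z)) = measure_pmf.expectation (map_pmf fst ?p) (g j)"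
      by simp
    then show ?thesis
      unfolding map_fst_pair_pmf by (simp add: integral_pmf_of_set ne)
  qed
  have "measure_pmf.expectation (stream_pmf N K) (\<lambda>x. \<Prod>j<N. g j (fst (x j)))
      = (\<Prod>j<N. measure_pmf.expectation ?p (\<lambda>z. g j (fst z)))"
    unfolding stream_pmf_def
    by (rule expectation_prod_Pi_pmf) (auto intro!: integrable_measure_pmf_finite simp: ne nonneg)
  then show ?thesis
    by (simp only: marginal ptr_def)
qed

text \<open>The attribute of \<open>i\<close> is independent of its pointer and of all other
  keyframes, so a fresh uniform draw in its place leaves the law unchanged.\<close>

lemma stream_resample_attr:
  assumes "i < N"
  shows "stream_pmf N K = bind_pmf (stream_pmf N K)
    (\<lambda>x. map_pmf (\<lambda>a. x(i := (ptr x i, a))) (pmf_of_set {..<K}))"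
proof -
  have ins: "{..<N} = insert i ({..<N} - {i})"
    using assms by auto
  show ?thesis
    unfolding stream_pmf_def
    by (subst (1 2) ins, subst (1 2) Pi_pmf_insert')
       (auto simp: pair_pmf_def map_pmf_def bind_assoc_pmf bind_return_pmf ptr_def
         bind_return_pmf' intro!: bind_pmf_cong,
        subst (2) bind_commute_pmf, simp)
qed


subsection \<open>Localisation\<close>

text \<open>Averaging over the randomness of the selection turns the retrieved set into fractional
  memberships in [0, 1], which treats randomized and deterministic selections alike.\<close>

definition reach :: "'s agent \<Rightarrow> nat \<Rightarrow> 's \<Rightarrow> nat \<Rightarrow> real" where
  "reach ag j s p = measure_pmf.prob (select ag j s) {W. p \<in> W}"

text \<open>Exchanging sum and expectation makes the left-hand side the expected cardinality of the
  retrieved set.\<close>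

lemma sum_reach_le:
  assumes "\<And>W. W \<in> set_pmf (select ag j s) \<Longrightarrow> W \<subseteq> {..<N} \<and> card W \<le> k"
  shows "(\<Sum>p<N. reach ag j s p) \<le> real k"
proof -
  have "(\<Sum>p<N. reach ag j s p)
      = (\<Sum>p<N. measure_pmf.expectation (select ag j s) (\<lambda>W. indicator {W. p \<in> W} W))"
    by (simp add: reach_def)
  also have "\<dots> = measure_pmf.expectation (select ag j s) (\<lambda>W. \<Sum>p<N. indicator {W. p \<in> W} W)"
    by (rule Bochner_Integration.integral_sum[symmetric])
       (auto intro: measure_pmf.integrable_const_bound[where B=1])
  also have "\<dots> \<le> real k"
  proof (rule expectation_le_const)
    fix W assume "W \<in> set_pmf (select ag j s)"
    then have W: "W \<subseteq> {..<N}" "card W \<le> k"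
      using assms by auto
    have "(\<Sum>p<N. indicator {W. p \<in> W} W) = (\<Sum>p<N. if p \<in> W then 1 else (0::real))"
      by (intro sum.cong) (auto simp: indicator_def)
    also have "\<dots> = real (card ({..<N} \<inter> W))"
      by (simp add: sum.If_cases)
    also have "{..<N} \<inter> W = W"
      using W by auto
    finally show "(\<Sum>p<N. indicator {W. p \<in> W} W) \<le> real k"
      using W by simp
  qed (auto intro: sum_nonneg)
  finally show ?thesis .
qed

text \<open>The query is drawn independently of stream and state, so given these two there remains a
  plain average over \<open>j\<close>.\<close>

lemma prob_reached_eq:
  assumes "N \<ge> 1"
  shows "measure_pmf.prob (run N K ag) {(x, j, W, y). ptr x j \<in> W}
    = measure_pmf.expectation (stream_pmf N K) (\<lambda>x. measure_pmf.expectation (state ag x)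
        (\<lambda>s. (\<Sum>j<N. reach ag j s (ptr x j)) / real N))"
proof -
  have ne: "{..<N} \<noteq> {}"
    using assms by (auto simp: lessThan_empty_iff)
  have ind: "measure_pmf.expectation p (\<lambda>W. of_bool (q \<in> W)) = measure_pmf.prob p {W. q \<in> W}"
    for p :: "nat set pmf" and q
  proof -
    have "(\<lambda>W. of_bool (q \<in> W)) = (indicator {W. q \<in> W} :: nat set \<Rightarrow> real)"
      by (auto simp: fun_eq_iff)
    then show ?thesis
      by simp
  qed
  show ?thesis
    unfolding run_def
    by (simp only: prob_bind_pmf prob_return_pmf mem_Collect_eq case_prod_conv)
       (simp add: integral_pmf_of_set ne reach_def ind)
qed

lemma reach_bounds: "0 \<le> reach ag j s p" "reach ag j s p \<le> 1"
  by (auto simp: reach_def)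

text \<open>With a single state the selection depends on \<open>j\<close> only, so the uniform
  pointer of \<open>j\<close> is independent of a set that holds at most \<open>k\<close> of its
  \<open>N\<close> possible values.\<close>

lemma prob_reached_unit:
  fixes ag :: "unit agent"
  assumes "N \<ge> 1" "K \<ge> 1" "retrieves_at_most N K k ag"
  shows "measure_pmf.prob (run N K ag) {(x, j, W, y). ptr x j \<in> W} \<le> real k / real N"
proof -
  \<comment> \<open>The cardinality bound is given only for streams and states in the support, so
    some stream of the support is needed to apply it.\<close>
  obtain x0 where x0: "x0 \<in> set_pmf (stream_pmf N K)"
    using set_pmf_not_empty by fast
  have st: "state ag x = return_pmf ()" for x
    using set_pmf_subset_singleton[of "state ag x" "()"] by auto
  have sum: "(\<Sum>p<N. reach ag j () p) \<le> real k" if "j < N" for j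
    by (rule sum_reach_le) (use assms(3) x0 st that in \<open>auto simp: retrieves_at_most_def\<close>)
  have "measure_pmf.prob (run N K ag) {(x, j, W, y). ptr x j \<in> W}
      = measure_pmf.expectation (stream_pmf N K) (\<lambda>x. (\<Sum>j<N. reach ag j () (ptr x j)) / real N)"
    using assms by (simp add: prob_reached_eq st)
  also have "\<dots> = (\<Sum>j<N. measure_pmf.expectation (stream_pmf N K) (\<lambda>x. reach ag j () (ptr x j))) / real N"
    using finite_set_pmf_stream[OF assms(1,2)]
    by (simp add: Bochner_Integration.integral_sum integrable_measure_pmf_finite)
  also have "\<dots> = (\<Sum>j<N. (\<Sum>p<N. reach ag j () p) / real N) / real N"
    using assms by (simp add: expectation_ptr_stream)
  also have "\<dots> \<le> (\<Sum>j<N. real k / real N) / real N"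
    by (intro divide_right_mono sum_mono) (auto simp: sum)
  also have "\<dots> = real k / real N"
    using assms by simp
  finally show ?thesis .
qed

lemma prob_reached_bit_state:
  fixes ag :: "bool list agent"
  assumes N: "N \<ge> 1" and K: "K \<ge> 1" and k: "k \<ge> 1" "k < N"
    and ret: "retrieves_at_most N K k ag" and bit: "bit_state N K m ag"
  shows "measure_pmf.prob (run N K ag) {(x, j, W, y). ptr x j \<in> W}
    \<le> (real m / real N + 1) / log 2 (real N / real k)"
proof -
  let ?P = "stream_pmf N K"
  define l where "l = ln (real N / real k)"
  \<comment> \<open>\<open>exp c\<close> is \<open>2 ^ m * 2 ^ N\<close>: the bound on the number of
    states times the bound on the moment of each.\<close>
  define c where "c = ln 2 * (real m + real N)"
  define S where "S = (\<Union>x\<in>set_pmf ?P. set_pmf (state ag x))"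
  define Z where "Z = (\<lambda>x s. \<Sum>j<N. reach ag j s (ptr x j))"
  \<comment> \<open>The sum over all of \<open>S\<close> dominates the term of the actual state,
    however that state depends on the stream; \<open>exp (- c)\<close> normalises the mean to at
    most 1.\<close>
  define g where "g = (\<lambda>x. exp (- c) * (\<Sum>s\<in>S. exp (l * Z x s)))"
  have l: "l > 0" and el: "exp l = real N / real k"
    using k by (auto simp: l_def)
  have ec: "exp c = 2 ^ m * 2 ^ N"
  proof -
    have "exp c = exp (real (m + N) * ln 2)"
      by (simp add: c_def mult.commute)
    also have "\<dots> = exp (ln 2) ^ (m + N)"
      by (rule exp_of_nat_mult)
    finally show ?thesis
      by (simp add: power_add)
  qed
  have S_sub: "S \<subseteq> {s. set s \<subseteq> UNIV \<and> length s = m}"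
    using bit by (auto simp: S_def bit_state_def)
  have finS: "finite S"
    by (rule finite_subset[OF S_sub finite_lists_length_eq]) simp
  have "card S \<le> card {s :: bool list. set s \<subseteq> UNIV \<and> length s = m}"
    by (rule card_mono[OF finite_lists_length_eq S_sub]) simp
  then have "card S \<le> 2 ^ m"
    by (subst (asm) card_lists_length_eq) auto
  then have cardS: "real (card S) \<le> 2 ^ m"
    by (metis of_nat_le_iff of_nat_numeral of_nat_power)
  have fin: "finite (set_pmf ?P)"
    using finite_set_pmf_stream N K by blast
  \<comment> \<open>As \<open>exp l\<close> is \<open>N / k\<close>, the chord bound makes the sum
    at most \<open>N + (N / k - 1) * k\<close>, which is below \<open>2 * N\<close>.\<close>
  have factor: "(\<Sum>p<N. exp (l * reach ag j s p)) / real N \<le> 2" if "s \<in> S" "j < N" for s j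
  proof -
    have "(\<Sum>p<N. exp (l * reach ag j s p)) \<le> (\<Sum>p<N. 1 + reach ag j s p * (exp l - 1))"
      using l by (intro sum_mono exp_mult_le_chord) (auto simp: reach_bounds)
    also have "\<dots> = real N + (exp l - 1) * (\<Sum>p<N. reach ag j s p)"
      by (simp add: sum.distrib sum_distrib_left mult.commute)
    also have "\<dots> \<le> real N + (exp l - 1) * real k"
    proof (intro add_left_mono mult_left_mono sum_reach_le)
      fix W assume "W \<in> set_pmf (select ag j s)"
      then show "W \<subseteq> {..<N} \<and> card W \<le> k"
        using ret that unfolding S_def retrieves_at_most_def by blast
    qed (use l in simp)
    also have "\<dots> \<le> 2 * real N"
      using k by (simp add: el field_simps)
    finally show ?thesis
      using N by (simp add: field_simps)
  qed
  \<comment> \<open>Here \<open>s\<close> is fixed before the stream is drawn, so the factors for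
    different \<open>j\<close> are independent.\<close>
  have moment: "measure_pmf.expectation ?P (\<lambda>x. exp (l * Z x s)) \<le> 2 ^ N" if "s \<in> S" for s
  proof -
    have "measure_pmf.expectation ?P (\<lambda>x. exp (l * Z x s))
        = measure_pmf.expectation ?P (\<lambda>x. \<Prod>j<N. exp (l * reach ag j s (ptr x j)))"
      by (simp add: Z_def sum_distrib_left exp_sum)
    also have "\<dots> = (\<Prod>j<N. (\<Sum>p<N. exp (l * reach ag j s p)) / real N)"
      by (rule expectation_prod_stream[OF N K]) simp
    also have "\<dots> \<le> (\<Prod>j<N. 2)"
      using factor that by (intro prod_mono) (auto intro!: divide_nonneg_nonneg sum_nonneg)
    finally show ?thesis
      by simp
  qed
  have Eg: "measure_pmf.expectation ?P g \<le> 1"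
  proof -
    have "measure_pmf.expectation ?P g
        = exp (- c) * (\<Sum>s\<in>S. measure_pmf.expectation ?P (\<lambda>x. exp (l * Z x s)))"
      unfolding g_def
      by (simp add: Bochner_Integration.integral_sum integrable_measure_pmf_finite fin)
    also have "\<dots> \<le> exp (- c) * (\<Sum>s\<in>S. 2 ^ N)"
      by (intro mult_left_mono sum_mono moment) auto
    also have "\<dots> \<le> exp (- c) * exp c"
      unfolding ec using mult_right_mono[OF cardS, of "2 ^ N"] by (intro mult_left_mono) auto
    finally show ?thesis
      by (simp flip: exp_add)
  qed
  have Z0: "0 \<le> Z x s" for x s
    by (auto simp: Z_def intro: sum_nonneg reach_bounds)
  \<comment> \<open>This is \<open>1 + u <= exp u\<close> at \<open>u = l * Z x s - c\<close>,
    followed by keeping one summand of \<open>g\<close>.\<close>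
  have pointwise: "Z x s \<le> (c - 1 + g x) / l" if "s \<in> S" for x s
  proof -
    have "1 + (l * Z x s - c) \<le> exp (l * Z x s - c)"
      by (rule exp_ge_add_one_self)
    also have "\<dots> = exp (- c) * exp (l * Z x s)"
      by (simp flip: exp_add)
    also have "\<dots> \<le> g x"
      unfolding g_def
      by (intro mult_left_mono member_le_sum) (use that finS in auto)
    finally show ?thesis
      using l by (simp add: field_simps)
  qed
  \<comment> \<open>The shift \<open>c\<close> makes the right-hand side \<open>(c - 1 + g x) / l\<close> average to at most \<open>c / l\<close>.\<close>
  have "measure_pmf.prob (run N K ag) {(x, j, W, y). ptr x j \<in> W}
      = measure_pmf.expectation ?P (\<lambda>x. measure_pmf.expectation (state ag x) (\<lambda>s. Z x s / real N))"
    by (simp only: prob_reached_eq[OF N] Z_def)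
  also have "\<dots> \<le> measure_pmf.expectation ?P (\<lambda>x. (c - 1 + g x) / l / real N)"
  proof (rule integral_mono_AE)
    show "AE x in ?P. measure_pmf.expectation (state ag x) (\<lambda>s. Z x s / real N) \<le> (c - 1 + g x) / l / real N"
      unfolding AE_measure_pmf_iff
    proof
      fix x assume "x \<in> set_pmf ?P"
      then show "measure_pmf.expectation (state ag x) (\<lambda>s. Z x s / real N) \<le> (c - 1 + g x) / l / real N"
        by (intro expectation_le_const divide_right_mono pointwise) (auto simp: S_def Z0)
    qed
  qed (auto intro: integrable_measure_pmf_finite fin)
  also have "\<dots> = (c - 1 + measure_pmf.expectation ?P g) / l / real N"
    by (simp add: integrable_measure_pmf_finite fin)
  also have "\<dots> \<le> c / l / real N"
    using Eg l by (intro divide_right_mono) auto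
  \<comment> \<open>The factor \<open>ln 2\<close> of \<open>c\<close> turns the natural logarithm
    \<open>l\<close> into a logarithm to base 2.\<close>
  also have "\<dots> = (real m / real N + 1) / log 2 (real N / real k)"
    using N l by (simp add: c_def log_def l_def[symmetric] field_simps)
  finally show ?thesis .
qed


text \<open>For fixed \<open>k\<close>, \<open>log 2 (n / k)\<close> is asymptotic to
  \<open>log 2 n\<close>, so the first summand behaves like \<open>m n / (n * log 2 n)\<close>; the
  second is the reciprocal of a diverging logarithm.\<close>

lemma localisation_bound_tendsto_0:
  fixes m :: "nat \<Rightarrow> nat"
  assumes "k \<ge> 1" and m: "(\<lambda>n. real (m n)) \<in> o(\<lambda>n. real n * log 2 (real n))"
  shows "(\<lambda>n. (real (m n) / real n + 1) / log 2 (real n / real k)) \<longlonglongrightarrow> 0"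
proof -
  have k: "real k > 0"
    using assms(1) by simp
  have "(\<lambda>n. real (m n) / (real n * log 2 (real n))) \<longlonglongrightarrow> 0"
    by (rule smalloD_tendsto[OF m])
  moreover have "(\<lambda>n. log 2 (real n) / log 2 (real n / real k)) \<longlonglongrightarrow> 1"
    using k by real_asymp
  moreover have "(\<lambda>n. 1 / log 2 (real n / real k)) \<longlonglongrightarrow> 0"
    using k by real_asymp
  ultimately have "(\<lambda>n. real (m n) / (real n * log 2 (real n)) * (log 2 (real n) / log 2 (real n / real k))
      + 1 / log 2 (real n / real k)) \<longlonglongrightarrow> 0 * 1 + 0"
    by (intro tendsto_intros)
  then have "(\<lambda>n. real (m n) / (real n * log 2 (real n)) * (log 2 (real n) / log 2 (real n / real k))
      + 1 / log 2 (real n / real k)) \<longlonglongrightarrow> 0"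
    by simp
  moreover have "eventually (\<lambda>n. real (m n) / (real n * log 2 (real n)) * (log 2 (real n) / log 2 (real n / real k))
      + 1 / log 2 (real n / real k) = (real (m n) / real n + 1) / log 2 (real n / real k)) sequentially"
    \<comment> \<open>Beyond 1 both \<open>n\<close> and \<open>log 2 n\<close> are nonzero and
      cancel.\<close>
    using eventually_gt_at_top[of 1]
  proof eventually_elim
    case (elim n)
    then have "log 2 (real n) \<noteq> 0"
      by (simp add: log_def)
    then show ?case
      by (simp add: add_divide_distrib)
  qed
  ultimately show ?thesis
    by (blast intro: Lim_transform_eventually)
qed


subsection \<open>Capability\<close>

text \<open>The read-only condition and the event of reaching the target concern only this part of
  \<open>run\<close>; a read-grounded answer can be attached to it afterwards without the
  state.\<close>

definition retrieval :: "nat \<Rightarrow> nat \<Rightarrow> 's agent \<Rightarrow> (stream \<times> nat \<times> nat set) pmf" where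
  "retrieval N K ag = do {
     x \<leftarrow> stream_pmf N K;
     s \<leftarrow> state ag x;
     j \<leftarrow> pmf_of_set {..<N};
     W \<leftarrow> select ag j s;
     return_pmf (x, j, W)
   }"

lemma map_run: "map_pmf (\<lambda>(x, j, W, y). (x, j, W)) (run N K ag) = retrieval N K ag"
  by (simp add: run_def retrieval_def map_bind_pmf)

lemma prob_run_retrieval:
  "measure_pmf.prob (run N K ag) {(x, j, W, y). Q x j W} = measure_pmf.prob (retrieval N K ag) {(x, j, W). Q x j W}"
proof -
  have "(\<lambda>(x, j, W, y). (x, j, W)) -` {(x, j, W). Q x j W} = {(x, j, W, y :: nat). Q x j W}"
    by auto
  then show ?thesis
    unfolding map_run[symmetric] measure_map_pmf by simp
qed

text \<open>Packing the transcript into one variable \<open>t\<close> makes it a summation index;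
  \<open>fst (snd (snd t))\<close> is the retrieved set.\<close>

lemma read_only_retrieval_iff:
  "read_only_retrieval N K ag \<longleftrightarrow>
     (\<forall>t. \<forall>i\<in>{..<N} - fst (snd (snd t)). \<forall>v<K.
        measure_pmf.prob (retrieval N K ag) {(x, j, W). transcript x j W = t \<and> attr x i = v} =
        measure_pmf.prob (retrieval N K ag) {(x, j, W). transcript x j W = t} / real K)"
proof -
  have 1: "measure_pmf.prob (run N K ag) {(x, j, W, y). transcript x j W = t \<and> attr x i = v}
      = measure_pmf.prob (retrieval N K ag) {(x, j, W). transcript x j W = t \<and> attr x i = v}" for t i v
    by (rule prob_run_retrieval)
  have 2: "measure_pmf.prob (run N K ag) {(x, j, W, y). transcript x j W = t}
      = measure_pmf.prob (retrieval N K ag) {(x, j, W). transcript x j W = t}" for t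
    by (rule prob_run_retrieval)
  show ?thesis
    by (simp add: read_only_retrieval_def 1 2)
qed

lemma set_pmf_retrieval:
  assumes "N \<ge> 1" "(x, j, W) \<in> set_pmf (retrieval N K ag)"
  shows "x \<in> set_pmf (stream_pmf N K)" "j < N"
proof -
  have "{..<N} \<noteq> {}"
    using assms by (auto simp: lessThan_empty_iff)
  then show "x \<in> set_pmf (stream_pmf N K)" "j < N"
    using assms(2) by (auto simp: retrieval_def)
qed

text \<open>The probability is summed over transcripts and target values. The read-only condition
  replaces each joint mass by the transcript mass over \<open>K\<close>, and the answer
  probabilities then sum to 1 over the values.\<close>

lemma prob_correct_unreached:
  assumes N: "N \<ge> 1" and K: "K \<ge> 1"
    and ro: "read_only_retrieval N K ag" and rg: "read_grounded ag"
  shows "measure_pmf.prob (run N K ag) {(x, j, W, y). ptr x j \<notin> W \<and> y = attr x (ptr x j)}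
    \<le> measure_pmf.prob (run N K ag) {(x, j, W, y). ptr x j \<notin> W} / real K"
proof -
  let ?R = "retrieval N K ag"
  \<comment> \<open>Read-groundedness makes the answer the same for every state, so
    \<open>undefined\<close> can stand for the actual one.\<close>
  define ans where "ans = (\<lambda>j. answer ag j undefined)"
  define T where "T = (\<lambda>(x, j, W). transcript x j W)"
  define M where "M = map_pmf (\<lambda>(x, j, W). (transcript x j W, attr x (ptr x j))) ?R"
  define F :: "((nat \<Rightarrow> nat) \<times> nat \<times> nat set \<times> contents) \<times> nat \<Rightarrow> real"
    \<comment> \<open>\<open>F\<close> is the conditional probability of an unreached but correct
      answer, given the transcript and the target attribute; \<open>G\<close> is its sum over all
      attribute values.\<close>
    where "F = (\<lambda>((\<pi>, j, W, c), v). of_bool (\<pi> j \<notin> W) * pmf (ans j W c) v)"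
  define G :: "(nat \<Rightarrow> nat) \<times> nat \<times> nat set \<times> contents \<Rightarrow> real"
    where "G = (\<lambda>(\<pi>, j, W, c). of_bool (\<pi> j \<notin> W))"
  have F0: "0 \<le> F z" for z
    by (auto simp: F_def split: prod.splits)
  have G0: "0 \<le> G t" for t
    by (auto simp: G_def split: prod.splits)
  have FG: "(\<integral>\<^sup>+ v. ennreal (F (t, v)) \<partial>count_space UNIV) = ennreal (G t)" for t
  proof -
    obtain \<pi> j W c where t: "t = (\<pi>, j, W, c)"
      by (cases t)
    show ?thesis
      by (cases "\<pi> j \<in> W") (auto simp: t F_def G_def nn_integral_pmf measure_pmf.emeasure_eq_measure)
  qed
  have run: "run N K ag = bind_pmf ?R (\<lambda>(x, j, W). map_pmf (\<lambda>y. (x, j, W, y)) (ans j W (read x W)))"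
  proof -
    have "answer ag j s = ans j" for j s
      using rg by (auto simp: read_grounded_def ans_def fun_eq_iff)
    then show ?thesis
      by (simp add: run_def retrieval_def bind_assoc_pmf bind_return_pmf map_pmf_def)
  qed
  \<comment> \<open>The read-only condition speaks of a fixed index, whereas the target varies with
    the stream. A transcript includes the pointers, so fixing it fixes the target as
    \<open>\<pi> j\<close>. Pairs outside the support or with a reached target make the left-hand
    side 0.\<close>
  have bound: "ennreal (pmf M (t, v)) * ennreal (F (t, v))
      \<le> ennreal (pmf (map_pmf T ?R) t / real K) * ennreal (F (t, v))" for t v
  proof -
    obtain \<pi> j W c where t: "t = (\<pi>, j, W, c)"
      by (cases t)
    show ?thesis
    proof (cases "(t, v) \<in> set_pmf M \<and> \<pi> j \<notin> W")
      case True
      then obtain x where x: "(x, j, W) \<in> set_pmf ?R" "transcript x j W = t" "v = attr x (ptr x j)"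
        by (auto simp: M_def t transcript_def)
      then have xs: "x \<in> set_pmf (stream_pmf N K)" "j < N" and \<pi>: "\<pi> = ptr x"
        using set_pmf_retrieval[OF N x(1)] by (auto simp: t transcript_def)
      have i: "\<pi> j \<in> {..<N} - W" and v: "v < K"
        using set_pmf_stream[OF N K xs(1)] xs(2) True x(3) \<pi> by auto
      have "pmf M (t, v) = measure_pmf.prob ?R {(x, j', W'). transcript x j' W' = t \<and> attr x (\<pi> j) = v}"
        unfolding M_def pmf_map
        by (rule arg_cong[where f="measure_pmf.prob ?R"]) (auto simp: t transcript_def)
      also have "\<dots> = measure_pmf.prob ?R {(x, j', W'). transcript x j' W' = t} / real K"
        using ro i v unfolding read_only_retrieval_iff t by simp
      also have "{(x, j', W'). transcript x j' W' = t} = T -` {t}"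
        by (auto simp: T_def)
      finally show ?thesis
        by (simp add: pmf_map)
    next
      case False
      then have "pmf M (t, v) = 0 \<or> F (t, v) = 0"
        by (auto simp: set_pmf_iff t F_def)
      then show ?thesis
        by auto
    qed
  qed
  let ?E = "{(x, j, W, y). ptr x j \<notin> W \<and> y = attr x (ptr x j)}"
  have inner: "emeasure (map_pmf (\<lambda>y. (x, j, W, y)) (ans j W (read x W))) ?E
      = ennreal (F (transcript x j W, attr x (ptr x j)))" for x j W
  proof -
    have "(\<lambda>y. (x, j, W, y)) -` ?E = (if ptr x j \<in> W then {} else {attr x (ptr x j)})"
      by auto
    then show ?thesis
      by (simp add: F_def transcript_def emeasure_pmf_single)
  qed
  have "ennreal (measure_pmf.prob (run N K ag) ?E) = emeasure (run N K ag) ?E"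
    by (simp add: measure_pmf.emeasure_eq_measure)
  also have "\<dots> = (\<integral>\<^sup>+ (x, j, W). ennreal (F (transcript x j W, attr x (ptr x j))) \<partial>?R)"
    unfolding run emeasure_bind_pmf
    by (intro nn_integral_cong) (auto simp only: inner split: prod.split)
  also have "\<dots> = (\<integral>\<^sup>+ z. ennreal (F z) \<partial>M)"
    by (simp add: M_def case_prod_unfold)
  \<comment> \<open>As an integral over the counting measure the expectation splits into iterated
    sums, with the sum over attribute values inside.\<close>
  also have "\<dots> = (\<integral>\<^sup>+ z. ennreal (pmf M z) * ennreal (F z) \<partial>count_space UNIV)"
    by (rule nn_integral_measure_pmf)
  also have "\<dots> = (\<integral>\<^sup>+ t. \<integral>\<^sup>+ v. ennreal (pmf M (t, v)) * ennreal (F (t, v)) \<partial>count_space UNIV \<partial>count_space UNIV)"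
    by (rule nn_integral_fst_count_space[symmetric])
  also have "\<dots> \<le> (\<integral>\<^sup>+ t. \<integral>\<^sup>+ v. ennreal (pmf (map_pmf T ?R) t / real K) * ennreal (F (t, v)) \<partial>count_space UNIV \<partial>count_space UNIV)"
    by (intro nn_integral_mono bound)
  also have "\<dots> = (\<integral>\<^sup>+ t. ennreal (pmf (map_pmf T ?R) t / real K) * ennreal (G t) \<partial>count_space UNIV)"
    by (simp add: nn_integral_cmult FG)
  also have "\<dots> = (\<integral>\<^sup>+ t. ennreal (pmf (map_pmf T ?R) t) * ennreal (G t / real K) \<partial>count_space UNIV)"
    by (simp add: G0 ennreal_mult'[symmetric])
  also have "\<dots> = (\<integral>\<^sup>+ t. ennreal (G t / real K) \<partial>map_pmf T ?R)"
    by (rule nn_integral_measure_pmf[symmetric])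
  also have "\<dots> = (\<integral>\<^sup>+ z. ennreal (1 / real K) * indicator {(x, j, W). ptr x j \<notin> W} z \<partial>?R)"
    by (auto simp: G_def T_def transcript_def indicator_def intro!: nn_integral_cong)
  also have "\<dots> = ennreal (1 / real K) * emeasure ?R {(x, j, W). ptr x j \<notin> W}"
    by (simp add: nn_integral_cmult)
  also have "\<dots> = ennreal (measure_pmf.prob (run N K ag) {(x, j, W, y). ptr x j \<notin> W} / real K)"
    by (simp add: measure_pmf.emeasure_eq_measure prob_run_retrieval flip: ennreal_mult')
  finally show ?thesis
    by (simp add: ennreal_le_iff)
qed

text \<open>Every run that reaches the target is counted as correct; the others are correct with
  conditional probability at most \<open>1 / K\<close>.\<close>

lemma prob_correct_le:
  assumes "N \<ge> 1" and "K \<ge> 1" and "read_only_retrieval N K ag" and "read_grounded ag"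
  defines "P \<equiv> measure_pmf.prob (run N K ag) {(x, j, W, y). ptr x j \<in> W}"
  shows "measure_pmf.prob (run N K ag) {(x, j, W, y). y = attr x (ptr x j)} \<le> P + (1 - P) / real K"
proof -
  have "{(x, j, W, y). ptr x j \<notin> W} = UNIV - {(x, j, W, y :: nat). ptr x j \<in> W}"
    by auto
  then have compl: "measure_pmf.prob (run N K ag) {(x, j, W, y). ptr x j \<notin> W} = 1 - P"
    unfolding P_def by (simp only: measure_pmf.prob_compl[simplified])
  have "measure_pmf.prob (run N K ag) {(x, j, W, y). y = attr x (ptr x j)}
      \<le> measure_pmf.prob (run N K ag) ({(x, j, W, y). ptr x j \<in> W}
          \<union> {(x, j, W, y). ptr x j \<notin> W \<and> y = attr x (ptr x j)})"
    by (rule measure_pmf.finite_measure_mono) auto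
  also have "\<dots> \<le> P + measure_pmf.prob (run N K ag) {(x, j, W, y). ptr x j \<notin> W \<and> y = attr x (ptr x j)}"
    unfolding P_def by (rule measure_Un_le) auto
  also have "\<dots> \<le> P + (1 - P) / real K"
    using prob_correct_unreached[OF assms(1-4)] by (simp add: compl)
  finally show ?thesis .
qed

lemma read_only_retrieval_unit:
  fixes ag :: "unit agent"
  assumes K: "K \<ge> 1"
  shows "read_only_retrieval N K ag"
  unfolding read_only_retrieval_iff
proof (intro allI ballI impI)
  fix t :: "(nat \<Rightarrow> nat) \<times> nat \<times> nat set \<times> contents" and i v
  assume i: "i \<in> {..<N} - fst (snd (snd t))" and v: "v < K"
  \<comment> \<open>Without a state, query and retrieved set are drawn independently of the
    stream.\<close>
  define q where "q = bind_pmf (pmf_of_set {..<N}) (\<lambda>j. map_pmf (Pair j) (select ag j ()))"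
  have st: "state ag x = return_pmf ()" for x
    using set_pmf_subset_singleton[of "state ag x" "()"] by auto
  have ret: "retrieval N K ag = bind_pmf (stream_pmf N K) (\<lambda>x. map_pmf (Pair x) q)"
    by (simp add: retrieval_def st q_def map_pmf_def bind_assoc_pmf bind_return_pmf)
  have neK: "{..<K} \<noteq> {}"
    using K by (auto simp: lessThan_empty_iff)
  \<comment> \<open>Keyframe \<open>i\<close> is not read and the transcript records only its
    pointer, so resampling its attribute goes unnoticed.\<close>
  have tr: "transcript (x(i := (ptr x i, a))) j' W' = t \<longleftrightarrow> transcript x j' W' = t" for x a j' W'
  proof -
    have "ptr (x(i := (ptr x i, a))) = ptr x"
      by (auto simp: ptr_def fun_eq_iff)
    moreover have "read (x(i := (ptr x i, a))) W = read x W" if "i \<notin> W" for W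
      using that by (auto simp: read_def restrict_map_def fun_eq_iff)
    ultimately show ?thesis
      using i by (cases t) (auto simp: transcript_def)
  qed
  let ?p = "\<lambda>x. measure_pmf.prob q {(j', W'). transcript x j' W' = t}"
  have "measure_pmf.prob (retrieval N K ag) {(x, j', W'). transcript x j' W' = t \<and> attr x i = v}
      = measure_pmf.expectation (stream_pmf N K)
          (\<lambda>x. measure_pmf.expectation (pmf_of_set {..<K}) (\<lambda>a. of_bool (a = v) * ?p x))"
  proof -
    have inner: "measure_pmf.prob (map_pmf (Pair (x(i := (ptr x i, a)))) q)
        {(x, j', W'). transcript x j' W' = t \<and> attr x i = v} = of_bool (a = v) * ?p x" for x a
    proof -
      have "Pair (x(i := (ptr x i, a))) -` {(x, j', W'). transcript x j' W' = t \<and> attr x i = v}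
          = (if a = v then {(j', W'). transcript x j' W' = t} else {})"
        by (auto simp: tr attr_def)
      then show ?thesis
        by simp
    qed
    have "retrieval N K ag = bind_pmf (stream_pmf N K) (\<lambda>x. bind_pmf (pmf_of_set {..<K})
        (\<lambda>a. map_pmf (Pair (x(i := (ptr x i, a)))) q))"
      unfolding ret by (subst stream_resample_attr[of i]) (use i in \<open>auto simp: bind_assoc_pmf bind_map_pmf\<close>)
    then show ?thesis
      by (simp only: prob_bind_pmf inner)
  qed
  also have "\<dots> = measure_pmf.expectation (stream_pmf N K) ?p / real K"
    using v by (simp add: integral_pmf_of_set neK of_bool_def if_distrib[where f="\<lambda>b. b * _"] cong: if_cong)
  also have "measure_pmf.expectation (stream_pmf N K) ?p
      = measure_pmf.prob (retrieval N K ag) {(x, j', W'). transcript x j' W' = t}"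
    unfolding ret prob_bind_pmf by (simp add: vimage_def)
  finally show "measure_pmf.prob (retrieval N K ag) {(x, j, W). transcript x j W = t \<and> attr x i = v} =
      measure_pmf.prob (retrieval N K ag) {(x, j, W). transcript x j W = t} / real K" .
qed


subsection \<open>Adaptive rounds\<close>

lemma rounds_add: "rounds ag x (r + r') c = bind_pmf (rounds ag x r c) (rounds ag x r')"
  by (induction r arbitrary: c) (auto simp: bind_return_pmf bind_assoc_pmf intro: bind_pmf_cong)

text \<open>Idle rounds preserve the finished memory, which extends the bound from \<open>d\<close>
  rounds to any \<open>R >= d\<close>.\<close>

lemma rounds_hop_agent_idle: "rounds (hop_agent N d B) x r (0, v) = return_pmf (0, v)"
  by (induction r) (simp_all add: hop_agent_def bind_return_pmf)

text \<open>Following the first pointer shortens the chain by one. The guard excludes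
  \<open>h = 0\<close>, where the truncated \<open>h - 1\<close> breaks the recursion.\<close>

lemma chain_answer_Suc: "h \<ge> 1 \<Longrightarrow> chain_answer x (Suc h) v = chain_answer x h (ptr x v)"
  by (cases h) (simp_all add: chain_answer_def funpow_swap1)

text \<open>The induction follows the correct trajectory only. It generalises over \<open>h\<close>
  and \<open>v\<close> because after one correct hop the rest is a chain of depth
  \<open>h - 1\<close> from the next keyframe.\<close>

lemma pmf_rounds_hop_agent:
  assumes N: "N \<ge> 1" and K: "K \<ge> 1" and x: "x \<in> set_pmf (stream_pmf N K)"
    and rs: "representationally_sufficient N K B \<epsilon>\<^sub>0 \<epsilon>\<^sub>1"
    and "r \<le> h" "1 \<le> h" "v < N"
  shows "pmf (rounds (hop_agent N d B) x r (h, v)) (resolved x h v r) \<ge> 1 - real r * \<epsilon>\<^sub>1"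
  using \<open>r \<le> h\<close> \<open>1 \<le> h\<close> \<open>v < N\<close>
proof (induction r arbitrary: h v)
  case 0
  then show ?case
    by (simp add: resolved_def)
next
  case (Suc r)
  let ?ag = "hop_agent N d B"
  let ?t = "if h = 1 then attr x v else ptr x v"
  have "{v} \<inter> {..<N} = {v}"
    using Suc.prems by auto
  then have step: "advance ?ag (h, v) (read x (request ?ag (h, v)))
      = map_pmf (Pair (h - 1)) (compose B (h = 1) v (read x {v}))"
    using Suc.prems by (simp add: hop_agent_def)
  have "pmf (compose B (h = 1) v (read x {v})) ?t \<ge> 1 - \<epsilon>\<^sub>1"
    using rs x Suc.prems unfolding representationally_sufficient_def
    by (cases "h = 1") (auto dest!: bspec[OF _ x] spec[where x="{v}"])
  moreover have "pmf (map_pmf (Pair (h - 1)) (compose B (h = 1) v (read x {v}))) (h - 1, ?t)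
      = pmf (compose B (h = 1) v (read x {v})) ?t"
    by (rule pmf_map_inj') (auto simp: inj_on_def)
  ultimately have a: "pmf (advance ?ag (h, v) (read x (request ?ag (h, v)))) (h - 1, ?t) \<ge> 1 - \<epsilon>\<^sub>1"
    by (simp only: step)
  have b: "pmf (rounds ?ag x r (h - 1, ?t)) (resolved x h v (Suc r)) \<ge> 1 - real r * \<epsilon>\<^sub>1"
  proof (cases "h = 1")
    case True
    then show ?thesis
      using Suc.prems by (simp add: resolved_def chain_answer_def)
  next
    case False
    then obtain h' where h': "h = Suc h'" "1 \<le> h'"
      using Suc.prems by (cases h) auto
    have "resolved x h v (Suc r) = resolved x h' (ptr x v) r"
      using h' by (simp add: resolved_def chain_answer_Suc funpow_swap1)
    then show ?thesis
      using Suc.IH[of h' "ptr x v"] Suc.prems h' set_pmf_stream(1)[OF N K x] by simp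
  qed
  \<comment> \<open>The lower bounds may be negative and cannot simply be multiplied; expanding
    \<open>(1 - a') * (1 - b') >= 0\<close> gives \<open>a' * b' >= a' + b' - 1\<close>
    instead.\<close>
  have "1 - real (Suc r) * \<epsilon>\<^sub>1 \<le> a' * b'"
    if "1 - \<epsilon>\<^sub>1 \<le> a'" "1 - real r * \<epsilon>\<^sub>1 \<le> b'" "a' \<le> 1" "b' \<le> 1" for a' b'
  proof -
    have "0 \<le> (1 - a') * (1 - b')"
      using that by simp
    then show ?thesis
      using that by (simp add: algebra_simps)
  qed
  from this[OF a b pmf_le_1 pmf_le_1]
  show ?case
    using pmf_bind_ge_mult order_trans by (fastforce)
qed

lemma prob_adaptive_run_ge:
  assumes N: "N \<ge> 1"
    and "\<And>x j. x \<in> set_pmf (stream_pmf N K) \<Longrightarrow> j < N \<Longrightarrow>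
      measure_pmf.prob (rounds ag x R (init ag j)) {c. Q x j c} \<ge> p"
  shows "measure_pmf.prob (adaptive_run N K ag R) {(x, j, c). Q x j c} \<ge> p"
proof -
  have ne: "{..<N} \<noteq> {}"
    using N by (auto simp: lessThan_empty_iff)
  show ?thesis
    unfolding adaptive_run_def map_pmf_def[symmetric]
    by (intro prob_bind_pmf_ge) (use assms(2) ne in \<open>auto simp: vimage_def\<close>)
qed

section \<open>Assembly of the retrieval bounds and the adaptive guarantee\<close>

theorem theorem4:
  fixes N K k :: nat
  assumes "N \<ge> 1" and "k \<ge> 1" and "K \<ge> 2" and "k < N"
  shows
    "\<comment> \<open>no cross-frame state: the state space is a singleton\<close>
     (\<forall>ag :: unit agent. retrieves_at_most N K k ag \<longrightarrow>
        measure_pmf.prob (run N K ag) {(x, j, W, y). y = attr x (ptr x j)}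
          \<le> real k / real N + (1 - real k / real N) * (1 / real K))
   \<and> \<comment> \<open>localisation\<close>
     (\<forall>m (ag :: bool list agent). retrieves_at_most N K k ag \<longrightarrow> bit_state N K m ag \<longrightarrow>
        measure_pmf.prob (run N K ag) {(x, j, W, y). ptr x j \<in> W}
          \<le> (real m / real N + 1) / log 2 (real N / real k))
   \<and> (\<forall>m :: nat \<Rightarrow> nat. (\<lambda>n. real (m n)) \<in> o(\<lambda>n. real n * log 2 (real n)) \<longrightarrow>
        (\<lambda>n. (real (m n) / real n + 1) / log 2 (real n / real k)) \<longlonglongrightarrow> 0 \<and>
        (\<forall>ag :: nat \<Rightarrow> bool list agent.
           (\<forall>n>k. retrieves_at_most n K k (ag n) \<and> bit_state n K (m n) (ag n)) \<longrightarrow>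
           (\<lambda>n. measure_pmf.prob (run n K (ag n)) {(x, j, W, y). ptr x j \<in> W}) \<longlonglongrightarrow> 0))
   \<and> \<comment> \<open>capability\<close>
     (\<forall>m (ag :: bool list agent). retrieves_at_most N K k ag \<longrightarrow> bit_state N K m ag \<longrightarrow>
        read_only_retrieval N K ag \<longrightarrow> read_grounded ag \<longrightarrow>
        measure_pmf.prob (run N K ag) {(x, j, W, y). y = attr x (ptr x j)}
          \<le> (real m / real N + 1) / log 2 (real N / real k) + 1 / real K)
   \<and> \<comment> \<open>adaptive rounds\<close>
     (\<forall>(B :: backbone) (\<epsilon>\<^sub>0 :: real) (\<epsilon>\<^sub>1 :: real) (d :: nat) (R :: nat).
        representationally_sufficient N K B \<epsilon>\<^sub>0 \<epsilon>\<^sub>1 \<longrightarrow> 1 \<le> d \<longrightarrow> d \<le> R \<longrightarrow>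
        (\<forall>c. request (hop_agent N d B) c \<subseteq> {..<N} \<and> card (request (hop_agent N d B) c) \<le> 1) \<and>
        (\<forall>r\<le>d. measure_pmf.prob (adaptive_run N K (hop_agent N d B) r)
                  {(x, j, c). c = resolved x d j r} \<ge> 1 - real r * \<epsilon>\<^sub>1) \<and>
        measure_pmf.prob (adaptive_run N K (hop_agent N d B) R)
          {(x, j, c). final_answer (hop_agent N d B) c = chain_answer x d j} \<ge> 1 - real d * \<epsilon>\<^sub>1)"
proof (intro conjI)
  have K: "K \<ge> 1"
    using \<open>K \<ge> 2\<close> by simp
  show "\<forall>ag :: unit agent. retrieves_at_most N K k ag \<longrightarrow>
        measure_pmf.prob (run N K ag) {(x, j, W, y). y = attr x (ptr x j)}
          \<le> real k / real N + (1 - real k / real N) * (1 / real K)"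
  proof (intro allI impI)
    fix ag :: "unit agent"
    assume ret: "retrieves_at_most N K k ag"
    define P where "P = measure_pmf.prob (run N K ag) {(x, j, W, y). ptr x j \<in> W}"
    have "measure_pmf.prob (run N K ag) {(x, j, W, y). y = attr x (ptr x j)} \<le> P + (1 - P) / real K"
      unfolding P_def
      by (rule prob_correct_le[OF \<open>N \<ge> 1\<close> K read_only_retrieval_unit[OF K]])
         (simp add: read_grounded_def)
    \<comment> \<open>In this form \<open>P\<close> has a nonnegative coefficient, so an upper bound
      on \<open>P\<close> can be inserted.\<close>
    also have "\<dots> = 1 / real K + (1 - 1 / real K) * P"
      using K by (simp add: field_simps)
    also have "\<dots> \<le> 1 / real K + (1 - 1 / real K) * (real k / real N)"
      using prob_reached_unit[OF \<open>N \<ge> 1\<close> K ret] K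
      by (intro add_left_mono mult_left_mono) (auto simp: P_def)
    also have "\<dots> = real k / real N + (1 - real k / real N) * (1 / real K)"
      by (simp add: algebra_simps)
    finally show "measure_pmf.prob (run N K ag) {(x, j, W, y). y = attr x (ptr x j)}
          \<le> real k / real N + (1 - real k / real N) * (1 / real K)" .
  qed
  show "\<forall>m (ag :: bool list agent). retrieves_at_most N K k ag \<longrightarrow> bit_state N K m ag \<longrightarrow>
        measure_pmf.prob (run N K ag) {(x, j, W, y). ptr x j \<in> W}
          \<le> (real m / real N + 1) / log 2 (real N / real k)"
    using prob_reached_bit_state \<open>N \<ge> 1\<close> K \<open>k \<ge> 1\<close> \<open>k < N\<close> by blast
  show "\<forall>m :: nat \<Rightarrow> nat. (\<lambda>n. real (m n)) \<in> o(\<lambda>n. real n * log 2 (real n)) \<longrightarrow>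
        (\<lambda>n. (real (m n) / real n + 1) / log 2 (real n / real k)) \<longlonglongrightarrow> 0 \<and>
        (\<forall>ag :: nat \<Rightarrow> bool list agent.
           (\<forall>n>k. retrieves_at_most n K k (ag n) \<and> bit_state n K (m n) (ag n)) \<longrightarrow>
           (\<lambda>n. measure_pmf.prob (run n K (ag n)) {(x, j, W, y). ptr x j \<in> W}) \<longlonglongrightarrow> 0)"
  proof (intro allI impI conjI)
    fix m :: "nat \<Rightarrow> nat"
    assume m: "(\<lambda>n. real (m n)) \<in> o(\<lambda>n. real n * log 2 (real n))"
    show lim: "(\<lambda>n. (real (m n) / real n + 1) / log 2 (real n / real k)) \<longlonglongrightarrow> 0"
      by (rule localisation_bound_tendsto_0[OF \<open>k \<ge> 1\<close> m])
    fix ag :: "nat \<Rightarrow> bool list agent"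
    assume ag: "\<forall>n>k. retrieves_at_most n K k (ag n) \<and> bit_state n K (m n) (ag n)"
    have "eventually (\<lambda>n. measure_pmf.prob (run n K (ag n)) {(x, j, W, y). ptr x j \<in> W}
        \<le> (real (m n) / real n + 1) / log 2 (real n / real k)) sequentially"
      using eventually_gt_at_top[of k]
      by eventually_elim (use ag \<open>k \<ge> 1\<close> K in \<open>auto intro!: prob_reached_bit_state\<close>)
    then show "(\<lambda>n. measure_pmf.prob (run n K (ag n)) {(x, j, W, y). ptr x j \<in> W}) \<longlonglongrightarrow> 0"
      by (intro tendsto_sandwich[OF _ _ tendsto_const lim]) auto
  qed
  show "\<forall>m (ag :: bool list agent). retrieves_at_most N K k ag \<longrightarrow> bit_state N K m ag \<longrightarrow>
        read_only_retrieval N K ag \<longrightarrow> read_grounded ag \<longrightarrow>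
        measure_pmf.prob (run N K ag) {(x, j, W, y). y = attr x (ptr x j)}
          \<le> (real m / real N + 1) / log 2 (real N / real k) + 1 / real K"
  proof (intro allI impI)
    fix m and ag :: "bool list agent"
    assume ag: "retrieves_at_most N K k ag" "bit_state N K m ag"
      "read_only_retrieval N K ag" "read_grounded ag"
    have "(1 - measure_pmf.prob (run N K ag) {(x, j, W, y). ptr x j \<in> W}) / real K \<le> 1 / real K"
      by (intro divide_right_mono) auto
    then show "measure_pmf.prob (run N K ag) {(x, j, W, y). y = attr x (ptr x j)}
          \<le> (real m / real N + 1) / log 2 (real N / real k) + 1 / real K"
      using prob_correct_le[OF \<open>N \<ge> 1\<close> K ag(3,4)]
        prob_reached_bit_state[OF \<open>N \<ge> 1\<close> K \<open>k \<ge> 1\<close> \<open>k < N\<close> ag(1,2)] by linarith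
  qed
  show "\<forall>(B :: backbone) (\<epsilon>\<^sub>0 :: real) (\<epsilon>\<^sub>1 :: real) (d :: nat) (R :: nat).
        representationally_sufficient N K B \<epsilon>\<^sub>0 \<epsilon>\<^sub>1 \<longrightarrow> 1 \<le> d \<longrightarrow> d \<le> R \<longrightarrow>
        (\<forall>c. request (hop_agent N d B) c \<subseteq> {..<N} \<and> card (request (hop_agent N d B) c) \<le> 1) \<and>
        (\<forall>r\<le>d. measure_pmf.prob (adaptive_run N K (hop_agent N d B) r)
                  {(x, j, c). c = resolved x d j r} \<ge> 1 - real r * \<epsilon>\<^sub>1) \<and>
        measure_pmf.prob (adaptive_run N K (hop_agent N d B) R)
          {(x, j, c). final_answer (hop_agent N d B) c = chain_answer x d j} \<ge> 1 - real d * \<epsilon>\<^sub>1"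
  proof (intro allI impI conjI)
    fix B :: backbone and \<epsilon>\<^sub>0 \<epsilon>\<^sub>1 :: real and d R :: nat
    assume rs: "representationally_sufficient N K B \<epsilon>\<^sub>0 \<epsilon>\<^sub>1" and d: "1 \<le> d" "d \<le> R"
    let ?ag = "hop_agent N d B"
    show "request ?ag c \<subseteq> {..<N}" for c
      by (cases c) (auto simp: hop_agent_def)
    show "card (request ?ag c) \<le> 1" for c
    proof (cases c)
      case (Pair h v)
      have "request ?ag c \<subseteq> {v}"
        by (auto simp: Pair hop_agent_def)
      from card_mono[OF _ this] show ?thesis
        by simp
    qed
    have init: "init ?ag j = (d, j)" for j
      by (simp add: hop_agent_def)
    show "1 - real r * \<epsilon>\<^sub>1 \<le> measure_pmf.prob (adaptive_run N K ?ag r) {(x, j, c). c = resolved x d j r}"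
      if "r \<le> d" for r
      using pmf_rounds_hop_agent[OF \<open>N \<ge> 1\<close> K _ rs that d(1)]
      by (intro prob_adaptive_run_ge \<open>N \<ge> 1\<close>) (simp add: init measure_pmf_single)
    show "1 - real d * \<epsilon>\<^sub>1 \<le> measure_pmf.prob (adaptive_run N K ?ag R)
        {(x, j, c). final_answer ?ag c = chain_answer x d j}"
    proof (intro prob_adaptive_run_ge \<open>N \<ge> 1\<close>)
      fix x j assume x: "x \<in> set_pmf (stream_pmf N K)" and j: "j < N"
      let ?z = "(0, chain_answer x d j)"
      have "1 - real d * \<epsilon>\<^sub>1 \<le> pmf (rounds ?ag x d (d, j)) ?z"
        using pmf_rounds_hop_agent[OF \<open>N \<ge> 1\<close> K x rs order_refl d(1) j] by (simp add: resolved_def)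
      \<comment> \<open>Once the chain is finished, the remaining \<open>R - d\<close> rounds keep
        \<open>?z\<close> with probability 1.\<close>
      also have "\<dots> = pmf (rounds ?ag x d (d, j)) ?z * pmf (rounds ?ag x (R - d) ?z) ?z"
        by (simp add: rounds_hop_agent_idle)
      also have "\<dots> \<le> pmf (rounds ?ag x R (d, j)) ?z"
        using pmf_bind_ge_mult rounds_add[of ?ag x d "R - d" "(d, j)"] d by simp
      also have "\<dots> \<le> measure_pmf.prob (rounds ?ag x R (d, j)) {c. snd c = chain_answer x d j}"
        unfolding measure_pmf_single[symmetric] by (rule measure_pmf.finite_measure_mono) auto
      finally show "1 - real d * \<epsilon>\<^sub>1 \<le> measure_pmf.prob (rounds ?ag x R (init ?ag j))
          {c. final_answer ?ag c = chain_answer x d j}"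
        by (simp add: init) (simp add: hop_agent_def)
    qed
  qed
qed

end
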